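(* Let $V$ be a vector space over the field of two elements, $U\subseteq V$ a subspace, and $P\subseteq V$ a spanning set of $V$ with $0\in P$ such that every coset of $U$ in $V$ contains at most one element of $P$. Let $s>1$. A tight set $S=\{\varphi_1,\dots,\varphi_s\}\subseteq P$ is strongly tight if and only if $\Sigma_{S'}=0$ for every subset $S'\subseteq S$ of cardinality $>1$.
   Context: For $S\subseteq V$, $\langle S\rangle$ denotes the subspace of $V$ generated by $S$. A set $S\subseteq V$ is tight if $\langle S\rangle\subseteq P+U$, and strongly tight if $\langle S\rangle\subseteq P$. For a finite tight set $S$ and a subset $S'\subseteq S$, let $p_{S'}$ be the unique element of $P$ in the coset $\big(\sum_{\varphi\in S'}\varphi\big)+U$ (in particular $p_\emptyset=0$), so that $\{p_{S'}+U : S'\subseteq S\}$ is the group generated by $S$ in $V/U$; then $\Sigma_S\in V$ is defined as $\Sigma_S=\sum_{S'\subseteq S}p_{S'}$. (In the motivating application $P$ is the set of quadratic $n$-fold Pfister forms, $V=I_q^nF$ and $U=I_q^{n+1}F$.) *)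

theory Defs
  imports Complex_Main "HOL-Library.Z2" "HOL-Library.Set_Algebras"
begin

text \<open>
  The space \<open>V\<close> is the type \<open>'v\<close>, with scalar multiplication \<open>scale\<close> over the two-element field
  \<^typ>\<open>bit\<close>; \<open>A + B\<close> on sets is the Minkowski sum and \<open>v +o U\<close> is the coset of \<open>v\<close> modulo \<open>U\<close>.
\<close>

definition tight ::
  "(bit \<Rightarrow> 'v \<Rightarrow> 'v) \<Rightarrow> 'v::ab_group_add set \<Rightarrow> 'v set \<Rightarrow> 'v set \<Rightarrow> bool" where
  "tight scale P U S \<longleftrightarrow> module.span scale S \<subseteq> P + U"

definition strongly_tight ::
  "(bit \<Rightarrow> 'v \<Rightarrow> 'v) \<Rightarrow> 'v::ab_group_add set \<Rightarrow> 'v set \<Rightarrow> bool" where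
  "strongly_tight scale P S \<longleftrightarrow> module.span scale S \<subseteq> P"

text \<open>
  Existence of the representative is ensured when \<open>T\<close> is a finite subset of a tight set, uniqueness
  when every coset of \<open>U\<close> contains at most one element of \<open>P\<close>; otherwise the value is unspecified.
\<close>

definition coset_rep :: "'v::ab_group_add set \<Rightarrow> 'v set \<Rightarrow> 'v set \<Rightarrow> 'v" where
  "coset_rep P U T = (THE p. p \<in> P \<and> p \<in> (\<Sum>\<phi>\<in>T. \<phi>) +o U)"

definition Sigma_tight :: "'v::ab_group_add set \<Rightarrow> 'v set \<Rightarrow> 'v set \<Rightarrow> 'v" where
  "Sigma_tight P U S = (\<Sum>T\<in>Pow S. coset_rep P U T)"

end

theory Submission
  imports Defs
begin

text \<open>
  A subset \<open>S'\<close> of \<open>S\<close> with at least two elements satisfies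
  \<open>(\<Sum>T\<in>Pow S'. \<Sum>T) = 0\<close>, because each element is counted \<open>2 ^ (card S' - 1)\<close> times, and
  \<open>S\<close> is strongly tight iff \<open>coset_rep P U T = \<Sum>T\<close> for all \<open>T \<subseteq> S\<close>. If all \<open>\<Sigma>\<close>-invariants vanish,
  these equations follow by induction on \<open>card T\<close>: in \<open>Sigma_tight P U T\<close> all summands but that
  of \<open>T\<close> itself are known, and comparing with the identity above determines the last one.
\<close>

lemma sum_Pow_insert:
  fixes g :: "'a set \<Rightarrow> 'b::comm_monoid_add"
  assumes "finite F" "x \<notin> F"
  shows "sum g (Pow (insert x F)) = (\<Sum>T\<in>Pow F. g T + g (insert x T))"
proof -
  have inj: "inj_on (insert x) (Pow F)"
    using assms(2) by (auto simp: inj_on_def)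
  have disj: "Pow F \<inter> insert x ` Pow F = {}"
    using assms(2) by auto
  have "sum g (Pow (insert x F)) = sum g (Pow F) + sum g (insert x ` Pow F)"
    unfolding Pow_insert by (intro sum.union_disjoint) (use assms(1) disj in auto)
  then show ?thesis
    by (simp add: sum.reindex[OF inj] sum.distrib)
qed

text \<open>Two pairings do the work: adding a fixed \<open>x\<close> to the subsets avoiding it
  leaves one copy of \<open>x\<close> per subset of the rest, and a second element \<open>y\<close>
  then cancels these copies in pairs.\<close>

lemma sum_Pow_subset_sums_eq_0:
  fixes A :: "'v::ab_group_add set"
  assumes char2: "\<And>v::'v. v + v = 0" and "finite A" "card A > 1"
  shows "(\<Sum>T\<in>Pow A. \<Sum>T) = 0"
proof -
  obtain x F where A: "A = insert x F" "x \<notin> F" "card F > 0"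
    using assms(3) by (metis One_nat_def Suc_less_eq2 card_eq_SucD)
  obtain y G where F: "F = insert y G" "y \<notin> G"
    using A(3) by (metis card_eq_SucD gr0_implies_Suc)
  have fin: "finite F" "finite G"
    using assms(2) A F by auto
  have "(\<Sum>T\<in>Pow A. \<Sum>T) = (\<Sum>T\<in>Pow F. \<Sum>T + \<Sum>(insert x T))"
    unfolding A(1) by (rule sum_Pow_insert) (use fin A in auto)
  also have "\<dots> = (\<Sum>T\<in>Pow F. x)"
  proof (rule sum.cong)
    fix T assume "T \<in> Pow F"
    then have "\<Sum>(insert x T) = x + \<Sum>T"
      using fin A(2) by (intro sum.insert) (auto intro: finite_subset)
    then show "\<Sum>T + \<Sum>(insert x T) = x"
      using char2[of "\<Sum>T"] by (simp add: add.left_commute)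
  qed simp
  \<comment> \<open>Here \<open>card A > 1\<close> matters: the summand is constantly
    \<open>x\<close>, and it is paired along the second element \<open>y\<close>.\<close>
  also have "\<dots> = (\<Sum>T\<in>Pow G. x + x)"
    unfolding F(1) by (rule sum_Pow_insert) (use fin F in auto)
  finally show ?thesis
    by (simp add: char2)
qed

lemma vector_space_bit_add_self:
  fixes scale :: "bit \<Rightarrow> 'v::ab_group_add \<Rightarrow> 'v" and v :: 'v
  assumes "vector_space scale"
  shows "v + v = 0"
proof -
  interpret vector_space scale by fact
  have "v + v = scale (1 + 1) v"
    unfolding scale_left_distrib by simp
  then show ?thesis by simp
qed

text \<open>A coefficient in \<open>bit\<close> only says whether a vector is taken or not, so
  linear combinations are subset sums.\<close>

lemma span_bit_finite:
  fixes scale :: "bit \<Rightarrow> 'v::ab_group_add \<Rightarrow> 'v"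
  assumes "vector_space scale" "finite S"
  shows "module.span scale S = Sum ` Pow S"
proof -
  interpret vector_space scale by fact
  show ?thesis
  proof (intro equalityI subsetI)
    fix v assume "v \<in> span S"
    then obtain u where v: "v = (\<Sum>w\<in>S. scale (u w) w)"
      using span_finite[OF assms(2)] by auto
    have "scale (u w) w = (if u w = 1 then w else 0)" for w
      by (cases "u w") auto
    then have "v = \<Sum>{w\<in>S. u w = 1}"
      using assms(2) by (simp add: v sum.If_cases Int_def)
    then show "v \<in> Sum ` Pow S"
      by auto
  next
    fix v assume "v \<in> Sum ` Pow S"
    then show "v \<in> span S"
      by (auto intro: span_sum span_base)
  qed
qed

lemma coset_rep_eq:
  assumes "\<exists>\<^sub>\<le>\<^sub>1 p. p \<in> P \<and> p \<in> \<Sum>T +o U" "p \<in> P" "p \<in> \<Sum>T +o U"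
  shows "coset_rep P U T = p"
  unfolding coset_rep_def using assms by (intro the1_equality') auto

lemma coset_rep_mem:
  assumes "\<exists>\<^sub>\<le>\<^sub>1 p. p \<in> P \<and> p \<in> \<Sum>T +o U" "\<exists>p\<in>P. p \<in> \<Sum>T +o U"
  shows "coset_rep P U T \<in> P"
  using assms coset_rep_eq by metis

theorem theorem7p2:
  fixes scale :: "bit \<Rightarrow> 'v::ab_group_add \<Rightarrow> 'v"
    and U P S :: "'v set"
    and s :: nat
  assumes "vector_space scale"
    and "module.subspace scale U"
    and "module.span scale P = UNIV"
    and "0 \<in> P"
    and "\<forall>v. \<exists>\<^sub>\<le>\<^sub>1 p. p \<in> P \<and> p \<in> v +o U"
    and "s > 1"
    and "finite S"
    and "card S = s"
    and "S \<subseteq> P"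
    and "tight scale P U S"
  shows "strongly_tight scale P S \<longleftrightarrow>
    (\<forall>S'. S' \<subseteq> S \<and> card S' > 1 \<longrightarrow> Sigma_tight P U S' = 0)"
proof -
  interpret vector_space scale by fact
  have char2: "v + v = 0" for v :: 'v
    using vector_space_bit_add_self[OF assms(1)] .
  have span_S: "span S = Sum ` Pow S"
    by (rule span_bit_finite) fact+
  have uniq: "\<exists>\<^sub>\<le>\<^sub>1 p. p \<in> P \<and> p \<in> v +o U" for v
    using assms(5) by blast
  have U0: "0 \<in> U" and U_neg: "\<And>u. u \<in> U \<Longrightarrow> - u \<in> U"
    using assms(2) by (auto intro: subspace_0 subspace_neg)
  have self_mem: "v \<in> v +o U" for v
    using U0 by (auto simp: elt_set_plus_def)
  \<comment> \<open>A subset sum always lies in its own coset; once it is in \<open>P\<close>,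
    uniqueness makes it the representative.\<close>
  have rep_eq: "coset_rep P U T = \<Sum>T" if "\<Sum>T \<in> P" for T
    using coset_rep_eq[OF uniq that self_mem] .
  have rep_mem: "coset_rep P U T \<in> P" if "T \<subseteq> S" for T
  proof (rule coset_rep_mem[OF uniq])
    \<comment> \<open>Tightness is what makes a representative exist: the \<open>P\<close>-part of
      this decomposition differs from \<open>\<Sum>T\<close> by an element of
      \<open>U\<close>.\<close>
    have "\<Sum>T \<in> P + U"
      using assms(10) that unfolding tight_def span_S by auto
    then obtain p u where pu: "p \<in> P" "u \<in> U" "\<Sum>T = p + u"
      by (auto elim: set_plus_elim)
    then have "p = \<Sum>T + (- u)"
      by simp
    then have "p \<in> \<Sum>T +o U"
      using U_neg[OF pu(2)] unfolding elt_set_plus_def by blast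
    then show "\<exists>p\<in>P. p \<in> \<Sum>T +o U"
      using pu(1) by blast
  qed
  have strongly_tight_iff: "strongly_tight scale P S \<longleftrightarrow> (\<forall>T\<subseteq>S. \<Sum>T \<in> P)"
    unfolding strongly_tight_def span_S by auto
  show ?thesis
  proof
    assume "strongly_tight scale P S"
    then have *: "\<And>T. T \<subseteq> S \<Longrightarrow> \<Sum>T \<in> P"
      using strongly_tight_iff by blast
    show "\<forall>S'. S' \<subseteq> S \<and> card S' > 1 \<longrightarrow> Sigma_tight P U S' = 0"
    proof (intro allI impI)
      fix S' assume S': "S' \<subseteq> S \<and> card S' > 1"
      have "Sigma_tight P U S' = (\<Sum>T\<in>Pow S'. \<Sum>T)"
        unfolding Sigma_tight_def using S' by (intro sum.cong refl rep_eq *) auto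
      also have "\<dots> = 0"
        using S' assms(7) by (intro sum_Pow_subset_sums_eq_0 char2) (auto intro: finite_subset)
      finally show "Sigma_tight P U S' = 0" .
    qed
  next
    assume Sigma_0: "\<forall>S'. S' \<subseteq> S \<and> card S' > 1 \<longrightarrow> Sigma_tight P U S' = 0"
    have "\<Sum>T \<in> P" if "finite T" "T \<subseteq> S" for T
      using that
    proof (induction T rule: finite_psubset_induct)
      case (psubset T)
      show ?case
      proof (cases "card T > 1")
        \<comment> \<open>The base cases, where no invariant is available: the empty sum is in
          \<open>P\<close> by \<open>0 \<in> P\<close>, a singleton sum by
          \<open>S \<subseteq> P\<close>.\<close>
        case False
        then consider "T = {}" | x where "T = {x}"
          using psubset.hyps by (metis One_nat_def card_0_eq card_1_singletonE less_one linorder_neqE_nat)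
        then show ?thesis
          using assms(4,9) psubset.prems by cases auto
      next
        case True
        have fin: "finite (Pow T)"
          using psubset.hyps by simp
        \<comment> \<open>By the induction hypothesis the sums of proper subsets lie in
          \<open>P\<close>, hence equal their representatives.\<close>
        have "coset_rep P U T + (\<Sum>T'\<in>Pow T - {T}. \<Sum>T')
            = coset_rep P U T + (\<Sum>T'\<in>Pow T - {T}. coset_rep P U T')"
          using psubset by (intro arg_cong2[of _ _ _ _ "(+)"] sum.cong refl rep_eq[symmetric]) auto
        also have "\<dots> = Sigma_tight P U T"
          unfolding Sigma_tight_def using fin by (intro sum.remove[symmetric]) auto
        \<comment> \<open>Both sides are zero, the left by assumption and the right by
          characteristic two.\<close>
        also have "\<dots> = (\<Sum>T'\<in>Pow T. \<Sum>T')"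
          using Sigma_0 True psubset sum_Pow_subset_sums_eq_0[OF char2, of T] by auto
        also have "\<dots> = \<Sum>T + (\<Sum>T'\<in>Pow T - {T}. \<Sum>T')"
          using fin by (intro sum.remove) auto
        finally have "coset_rep P U T = \<Sum>T"
          by simp
        \<comment> \<open>The representative of a subset of \<open>S\<close> is in \<open>P\<close>,
          so the equality puts \<open>\<Sum>T\<close> there too.\<close>
        then show ?thesis
          using rep_mem[OF psubset.prems] by simp
      qed
    qed
    then show "strongly_tight scale P S"
      unfolding strongly_tight_iff using assms(7) finite_subset by blast
  qed
qed

end
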